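(* For taut functors $F, G \colon \mathbf{Set} \to \mathbf{Set}$ there is a natural comparison $$\gamma \colon (\Delta[G] \circ F) \times \Delta[F] \to \Delta[G \circ F],$$ called the chain rule transformation. The natural transformation $\gamma$ is taut and monic.
   Context: A functor is taut if it preserves inverse image diagrams, i.e. pullback squares in which one leg is a monomorphism (pullbacks of a monomorphism along an arbitrary morphism). A natural transformation $t \colon F \to G$ is taut if for every monomorphism $m \colon A_0 \to A$ the naturality square of $t$ at $m$ is a pullback. Taut functors preserve monomorphisms, and composites of taut functors are taut. For a taut functor $F \colon \mathbf{Set} \to \mathbf{Set}$ let $j_X \colon X \to X+1$ be the coproduct injection. The difference functor of $F$ is $\Delta[F](X) = F(X+1) \setminus \mathrm{Im}\, F(j_X)$; for $f \colon X \to Y$, the function $\Delta[F](f)$ is the restriction of $F(f+1)$ (which does restrict, because $F$ is taut). It is a taut functor. The product $(\Delta[G]\circ F)\times \Delta[F]$ is computed pointwise: $A \mapsto \Delta[G](F(A)) \times \Delta[F](A)$. *)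

theory Defs
  imports Main "HOL-Library.FuncSet" "HOL-Library.Nat_Bijection"
begin

text \<open>
  HOL has no type of all sets, so the category \<open>Set\<close> is modelled by a family \<open>Obj\<close> of subsets
  (the small sets) of an arbitrary type, closed under subsets, binary products and \<open>X + 1\<close>.
  The elements of \<open>X + 1\<close> and \<open>X \<times> Y\<close> are coded in the same type by two arbitrary injections.
  Morphisms are all functions between small sets, as in \<open>X \<rightarrow>\<^sub>E Y\<close>.
  The extensions of the elements of a type of ZFC sets form such a family, and this instance is
  the category \<open>Set\<close> itself.  The axioms are only what the constructions below need, so every
  Grothendieck universe, and also the family of all finite sets, is covered too.
\<close>

record 'u setcat =
  Obj :: "'u set set"
  opt_code :: "'u option \<Rightarrow> 'u"
  pair_code :: "'u \<times> 'u \<Rightarrow> 'u"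

definition plus_one :: "'u setcat \<Rightarrow> 'u set \<Rightarrow> 'u set" where
  "plus_one S X = opt_code S ` insert None (Some ` X)"

definition binprod :: "'u setcat \<Rightarrow> 'u set \<Rightarrow> 'u set \<Rightarrow> 'u set" where
  "binprod S X Y = pair_code S ` (X \<times> Y)"

locale set_category =
  fixes S :: "'u setcat"
  assumes inj_opt_code: "inj (opt_code S)"
    and inj_pair_code: "inj (pair_code S)"
    and empty_Obj: "{} \<in> Obj S"
    and subset_Obj: "X \<in> Obj S \<Longrightarrow> Y \<subseteq> X \<Longrightarrow> Y \<in> Obj S"
    and plus_one_Obj: "X \<in> Obj S \<Longrightarrow> plus_one S X \<in> Obj S"
    and binprod_Obj: "X \<in> Obj S \<Longrightarrow> Y \<in> Obj S \<Longrightarrow> binprod S X Y \<in> Obj S"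

lemma set_category_nat:
  "set_category \<lparr>Obj = UNIV, opt_code = case_option 0 Suc, pair_code = prod_encode\<rparr>"
  by unfold_locales (auto simp: inj_def split: option.splits)

lemma set_category_finite_nat:
  "set_category \<lparr>Obj = {X. finite X}, opt_code = case_option 0 Suc, pair_code = prod_encode\<rparr>"
  by unfold_locales
    (auto simp: inj_def plus_one_def binprod_def intro: finite_subset split: option.splits)

definition coproj :: "'u setcat \<Rightarrow> 'u set \<Rightarrow> 'u \<Rightarrow> 'u" where
  "coproj S X = (\<lambda>x\<in>X. opt_code S (Some x))"

text \<open>The map \<open>[f, z] : X + 1 \<rightarrow> Z\<close> induced by \<open>f : X \<rightarrow> Z\<close> and \<open>z \<in> Z\<close>.\<close>

definition copair :: "'u setcat \<Rightarrow> 'u set \<Rightarrow> ('u \<Rightarrow> 'u) \<Rightarrow> 'u \<Rightarrow> 'u \<Rightarrow> 'u" where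
  "copair S X f z =
     (\<lambda>w\<in>plus_one S X. case inv (opt_code S) w of None \<Rightarrow> z | Some x \<Rightarrow> f x)"

definition plus_one_map :: "'u setcat \<Rightarrow> 'u set \<Rightarrow> 'u set \<Rightarrow> ('u \<Rightarrow> 'u) \<Rightarrow> 'u \<Rightarrow> 'u" where
  "plus_one_map S X Y f = copair S X (compose X (coproj S Y) f) (opt_code S None)"

definition binprod_map ::
  "'u setcat \<Rightarrow> 'u set \<Rightarrow> 'u set \<Rightarrow> ('u \<Rightarrow> 'u) \<Rightarrow> ('u \<Rightarrow> 'u) \<Rightarrow> 'u \<Rightarrow> 'u" where
  "binprod_map S X Y f g =
     (\<lambda>w\<in>binprod S X Y. case inv (pair_code S) w of (x, y) \<Rightarrow> pair_code S (f x, g y))"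

definition monomorphism :: "'u setcat \<Rightarrow> 'u set \<Rightarrow> 'u set \<Rightarrow> ('u \<Rightarrow> 'u) \<Rightarrow> bool" where
  "monomorphism S A B m \<longleftrightarrow>
     A \<in> Obj S \<and> B \<in> Obj S \<and> m \<in> A \<rightarrow>\<^sub>E B \<and>
     (\<forall>T\<in>Obj S. \<forall>g\<in>T \<rightarrow>\<^sub>E A. \<forall>h\<in>T \<rightarrow>\<^sub>E A. compose T m g = compose T m h \<longrightarrow> g = h)"

text \<open>
  The square with \<open>p : P \<rightarrow> A\<close>, \<open>q : P \<rightarrow> B\<close>, \<open>f : A \<rightarrow> C\<close>, \<open>g : B \<rightarrow> C\<close> is a pullback.
\<close>

definition pullback ::
  "'u setcat \<Rightarrow> 'u set \<Rightarrow> 'u set \<Rightarrow> 'u set \<Rightarrow> 'u set \<Rightarrow>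
   ('u \<Rightarrow> 'u) \<Rightarrow> ('u \<Rightarrow> 'u) \<Rightarrow> ('u \<Rightarrow> 'u) \<Rightarrow> ('u \<Rightarrow> 'u) \<Rightarrow> bool" where
  "pullback S P A B C p q f g \<longleftrightarrow>
     P \<in> Obj S \<and> A \<in> Obj S \<and> B \<in> Obj S \<and> C \<in> Obj S \<and>
     p \<in> P \<rightarrow>\<^sub>E A \<and> q \<in> P \<rightarrow>\<^sub>E B \<and> f \<in> A \<rightarrow>\<^sub>E C \<and> g \<in> B \<rightarrow>\<^sub>E C \<and>
     compose P f p = compose P g q \<and>
     (\<forall>T\<in>Obj S. \<forall>a\<in>T \<rightarrow>\<^sub>E A. \<forall>b\<in>T \<rightarrow>\<^sub>E B. compose T f a = compose T g b \<longrightarrow>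
        (\<exists>!u. u \<in> T \<rightarrow>\<^sub>E P \<and> compose T p u = a \<and> compose T q u = b))"

text \<open>
  An arrow of \<open>Set\<close> carries its domain and codomain, so the action on arrows takes them as
  arguments.
\<close>

record 'u endofun =
  ob :: "'u set \<Rightarrow> 'u set"
  ar :: "'u set \<Rightarrow> 'u set \<Rightarrow> ('u \<Rightarrow> 'u) \<Rightarrow> 'u \<Rightarrow> 'u"

definition set_functor :: "'u setcat \<Rightarrow> 'u endofun \<Rightarrow> bool" where
  "set_functor S F \<longleftrightarrow>
     (\<forall>X\<in>Obj S. ob F X \<in> Obj S) \<and>
     (\<forall>X\<in>Obj S. \<forall>Y\<in>Obj S. \<forall>f\<in>X \<rightarrow>\<^sub>E Y. ar F X Y f \<in> ob F X \<rightarrow>\<^sub>E ob F Y) \<and>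
     (\<forall>X\<in>Obj S. ar F X X (\<lambda>x\<in>X. x) = (\<lambda>x\<in>ob F X. x)) \<and>
     (\<forall>X\<in>Obj S. \<forall>Y\<in>Obj S. \<forall>Z\<in>Obj S. \<forall>f\<in>X \<rightarrow>\<^sub>E Y. \<forall>g\<in>Y \<rightarrow>\<^sub>E Z.
        ar F X Z (compose X g f) = compose (ob F X) (ar F Y Z g) (ar F X Y f))"

definition taut_functor :: "'u setcat \<Rightarrow> 'u endofun \<Rightarrow> bool" where
  "taut_functor S F \<longleftrightarrow>
     set_functor S F \<and>
     (\<forall>P A B C p q f g.
        monomorphism S B C g \<and> pullback S P A B C p q f g \<longrightarrow>
        pullback S (ob F P) (ob F A) (ob F B) (ob F C)
          (ar F P A p) (ar F P B q) (ar F A C f) (ar F B C g))"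

definition nat_trans ::
  "'u setcat \<Rightarrow> 'u endofun \<Rightarrow> 'u endofun \<Rightarrow> ('u set \<Rightarrow> 'u \<Rightarrow> 'u) \<Rightarrow> bool" where
  "nat_trans S F G t \<longleftrightarrow>
     set_functor S F \<and> set_functor S G \<and>
     (\<forall>X\<in>Obj S. t X \<in> ob F X \<rightarrow>\<^sub>E ob G X) \<and>
     (\<forall>X\<in>Obj S. \<forall>Y\<in>Obj S. \<forall>f\<in>X \<rightarrow>\<^sub>E Y.
        compose (ob F X) (t Y) (ar F X Y f) = compose (ob F X) (ar G X Y f) (t X))"

definition taut_trans ::
  "'u setcat \<Rightarrow> 'u endofun \<Rightarrow> 'u endofun \<Rightarrow> ('u set \<Rightarrow> 'u \<Rightarrow> 'u) \<Rightarrow> bool" where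
  "taut_trans S F G t \<longleftrightarrow>
     nat_trans S F G t \<and>
     (\<forall>A0 A m. monomorphism S A0 A m \<longrightarrow>
        pullback S (ob F A0) (ob F A) (ob G A0) (ob G A)
          (ar F A0 A m) (t A0) (t A) (ar G A0 A m))"

definition monic_trans ::
  "'u setcat \<Rightarrow> 'u endofun \<Rightarrow> 'u endofun \<Rightarrow> ('u set \<Rightarrow> 'u \<Rightarrow> 'u) \<Rightarrow> bool" where
  "monic_trans S F G t \<longleftrightarrow>
     nat_trans S F G t \<and> (\<forall>A\<in>Obj S. monomorphism S (ob F A) (ob G A) (t A))"

text \<open>Monic natural transformations are left cancellable in the functor category.\<close>

lemma monic_trans_cancel:
  assumes "monic_trans S F G t" "nat_trans S H F s" "nat_trans S H F s'"
    and "\<And>A. A \<in> Obj S \<Longrightarrow> compose (ob H A) (t A) (s A) = compose (ob H A) (t A) (s' A)"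
    and "A \<in> Obj S"
  shows "s A = s' A"
proof -
  have "monomorphism S (ob F A) (ob G A) (t A)"
    using assms(1,5) by (simp add: monic_trans_def)
  moreover have "ob H A \<in> Obj S" "s A \<in> ob H A \<rightarrow>\<^sub>E ob F A" "s' A \<in> ob H A \<rightarrow>\<^sub>E ob F A"
    using assms(2,3,5) by (simp_all add: nat_trans_def set_functor_def)
  ultimately show ?thesis
    using assms(4)[OF assms(5)] unfolding monomorphism_def by blast
qed

definition comp_functor :: "'u endofun \<Rightarrow> 'u endofun \<Rightarrow> 'u endofun" where
  "comp_functor G F =
     \<lparr>ob = \<lambda>X. ob G (ob F X),
      ar = \<lambda>X Y f. ar G (ob F X) (ob F Y) (ar F X Y f)\<rparr>"

definition binprod_functor :: "'u setcat \<Rightarrow> 'u endofun \<Rightarrow> 'u endofun \<Rightarrow> 'u endofun" where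
  "binprod_functor S F G =
     \<lparr>ob = \<lambda>X. binprod S (ob F X) (ob G X),
      ar = \<lambda>X Y f. binprod_map S (ob F X) (ob G X) (ar F X Y f) (ar G X Y f)\<rparr>"

definition diff_ob :: "'u setcat \<Rightarrow> 'u endofun \<Rightarrow> 'u set \<Rightarrow> 'u set" where
  "diff_ob S F X =
     ob F (plus_one S X) - ar F X (plus_one S X) (coproj S X) ` ob F X"

definition diff_functor :: "'u setcat \<Rightarrow> 'u endofun \<Rightarrow> 'u endofun" where
  "diff_functor S F =
     \<lparr>ob = diff_ob S F,
      ar = \<lambda>X Y f. restrict
        (ar F (plus_one S X) (plus_one S Y) (plus_one_map S X Y f)) (diff_ob S F X)\<rparr>"

text \<open>
  The source and target of the chain rule transformation, \<open>(\<Delta>[G] \<circ> F) \<times> \<Delta>[F]\<close> and \<open>\<Delta>[G \<circ> F]\<close>.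
\<close>

definition chain_source :: "'u setcat \<Rightarrow> 'u endofun \<Rightarrow> 'u endofun \<Rightarrow> 'u endofun" where
  "chain_source S G F =
     binprod_functor S (comp_functor (diff_functor S G) F) (diff_functor S F)"

definition chain_target :: "'u setcat \<Rightarrow> 'u endofun \<Rightarrow> 'u endofun \<Rightarrow> 'u endofun" where
  "chain_target S G F = diff_functor S (comp_functor G F)"

text \<open>
  An element \<open>a \<in> \<Delta>[F](A) \<subseteq> F(A + 1)\<close> gives a map \<open>[F(j), a] : F(A) + 1 \<rightarrow> F(A + 1)\<close>, where
  \<open>j : A \<rightarrow> A + 1\<close> is the coprojection.  The transformation sends \<open>(b, a)\<close>, with
  \<open>b \<in> \<Delta>[G](F(A)) \<subseteq> G(F(A) + 1)\<close>, to \<open>G([F(j), a])(b) \<in> G(F(A + 1))\<close>.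
\<close>

definition chain_rule ::
  "'u setcat \<Rightarrow> 'u endofun \<Rightarrow> 'u endofun \<Rightarrow> 'u set \<Rightarrow> 'u \<Rightarrow> 'u" where
  "chain_rule S G F A =
     (\<lambda>w\<in>ob (chain_source S G F) A.
        case inv (pair_code S) w of (b, a) \<Rightarrow>
          ar G (plus_one S (ob F A)) (ob F (plus_one S A))
            (copair S (ob F A) (ar F A (plus_one S A) (coproj S A)) a) b)"

end

theory Submission
  imports Defs
begin

text \<open>
  Everything is reduced to elements.  If \<open>a \<in> F(A + 1)\<close> lies outside the image of \<open>F(j)\<close>, then
  \<open>[F(j), a]\<close> is injective and \<open>j : F(A) \<rightarrow> F(A) + 1\<close> is the pullback of \<open>F(j)\<close> along it; for
  two different such \<open>a\<close>, \<open>a'\<close> the maps \<open>[F(j), a]\<close> and \<open>[F(j), a']\<close> intersect in \<open>F(A)\<close> only.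
  Since \<open>G\<close> preserves these pullbacks, \<open>\<gamma>\<close> is well defined and injective.  For tautness at a
  monomorphism \<open>m : A\<^sub>0 \<rightarrow> A\<close>, pull \<open>[F(j), a]\<close> back along \<open>F(m + 1)\<close>: the result is \<open>F(A\<^sub>0)\<close>
  if \<open>a\<close> is outside the image of \<open>F(m + 1)\<close>, and \<open>F(A\<^sub>0) + 1\<close> otherwise.
\<close>

section \<open>Functors evaluated at elements\<close>

lemma functor_ob: "set_functor S F \<Longrightarrow> X \<in> Obj S \<Longrightarrow> ob F X \<in> Obj S"
  by (simp add: set_functor_def)

lemma functor_ar:
  "set_functor S F \<Longrightarrow> X \<in> Obj S \<Longrightarrow> Y \<in> Obj S \<Longrightarrow> f \<in> X \<rightarrow>\<^sub>E Y \<Longrightarrow>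
   ar F X Y f \<in> ob F X \<rightarrow>\<^sub>E ob F Y"
  by (simp add: set_functor_def)

lemma functor_ar_mem:
  "set_functor S F \<Longrightarrow> X \<in> Obj S \<Longrightarrow> Y \<in> Obj S \<Longrightarrow> f \<in> X \<rightarrow>\<^sub>E Y \<Longrightarrow> u \<in> ob F X \<Longrightarrow>
   ar F X Y f u \<in> ob F Y"
  by (rule PiE_mem[OF functor_ar])

lemma functor_id:
  "set_functor S F \<Longrightarrow> X \<in> Obj S \<Longrightarrow> ar F X X (\<lambda>x\<in>X. x) = (\<lambda>x\<in>ob F X. x)"
  by (simp add: set_functor_def)

lemma compose_PiE: "f \<in> X \<rightarrow>\<^sub>E Y \<Longrightarrow> g \<in> Y \<rightarrow>\<^sub>E Z \<Longrightarrow> compose X g f \<in> X \<rightarrow>\<^sub>E Z"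
  by (auto simp: compose_def)

lemma functor_comp:
  assumes "set_functor S F" "X \<in> Obj S" "Y \<in> Obj S" "Z \<in> Obj S"
    and "f \<in> X \<rightarrow>\<^sub>E Y" "g \<in> Y \<rightarrow>\<^sub>E Z"
  shows "ar F X Z (compose X g f) = compose (ob F X) (ar F Y Z g) (ar F X Y f)"
  using assms unfolding set_functor_def by blast

text \<open>Commutativity is asked at points of \<open>X\<close>; as \<open>h\<close> and the
  composite are both extensional, they are equal as arrows, and functoriality can be evaluated at
  \<open>u\<close>.\<close>

lemma functor_triangle:
  assumes "set_functor S F" "X \<in> Obj S" "Y \<in> Obj S" "Z \<in> Obj S"
    and "f \<in> X \<rightarrow>\<^sub>E Y" "g \<in> Y \<rightarrow>\<^sub>E Z" "h \<in> X \<rightarrow>\<^sub>E Z"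
    and "\<And>x. x \<in> X \<Longrightarrow> g (f x) = h x"
    and "u \<in> ob F X"
  shows "ar F Y Z g (ar F X Y f u) = ar F X Z h u"
proof -
  have "compose X g f = h"
    using assms(7,8) by (intro extensionalityI[of _ X]) (auto simp: compose_eq PiE_def)
  then show ?thesis
    using functor_comp[OF assms(1-6)] assms(9) by (simp add: compose_eq)
qed

text \<open>Both sides are the value at \<open>u\<close> of \<open>F\<close> on the diagonal
  \<open>compose X g' f'\<close>; the square is split into two triangles along it.\<close>

lemma functor_square:
  assumes "set_functor S F" "X \<in> Obj S" "Y \<in> Obj S" "Y' \<in> Obj S" "Z \<in> Obj S"
    and "f \<in> X \<rightarrow>\<^sub>E Y" "g \<in> Y \<rightarrow>\<^sub>E Z" "f' \<in> X \<rightarrow>\<^sub>E Y'" "g' \<in> Y' \<rightarrow>\<^sub>E Z"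
    and "\<And>x. x \<in> X \<Longrightarrow> g (f x) = g' (f' x)"
    and "u \<in> ob F X"
  shows "ar F Y Z g (ar F X Y f u) = ar F Y' Z g' (ar F X Y' f' u)"
  using functor_triangle[OF assms(1,2,3,5,6,7) compose_PiE[OF assms(8,9)] _ assms(11)]
    functor_triangle[OF assms(1,2,4,5,8,9) compose_PiE[OF assms(8,9)] _ assms(11)] assms(10)
  by (simp add: compose_eq)

text \<open>Criterion for subfunctors, meant for \<Delta>[F] inside
  \<open>X \<mapsto> F(X + 1)\<close>. The laws are inherited at each element, because stability
  keeps the inner value of a composite in the domain of the outer restriction.\<close>

lemma functor_restrict:
  assumes F: "set_functor S F"
    and sub: "\<And>X. X \<in> Obj S \<Longrightarrow> D X \<subseteq> ob F X" "\<And>X. X \<in> Obj S \<Longrightarrow> D X \<in> Obj S"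
    and stable: "\<And>X Y f u. X \<in> Obj S \<Longrightarrow> Y \<in> Obj S \<Longrightarrow> f \<in> X \<rightarrow>\<^sub>E Y \<Longrightarrow> u \<in> D X \<Longrightarrow>
      ar F X Y f u \<in> D Y"
  shows "set_functor S \<lparr>ob = D, ar = \<lambda>X Y f. restrict (ar F X Y f) (D X)\<rparr>"
proof -
  have "restrict (ar F X X (\<lambda>x\<in>X. x)) (D X) = (\<lambda>x\<in>D X. x)" if "X \<in> Obj S" for X
    using F sub(1)[OF that] that by (auto simp: set_functor_def fun_eq_iff restrict_def)
  moreover have "restrict (ar F X Z (compose X g f)) (D X) =
      compose (D X) (restrict (ar F Y Z g) (D Y)) (restrict (ar F X Y f) (D X))"
    if "X \<in> Obj S" "Y \<in> Obj S" "Z \<in> Obj S" "f \<in> X \<rightarrow>\<^sub>E Y" "g \<in> Y \<rightarrow>\<^sub>E Z" for X Y Z f g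
    using functor_comp[OF F that] sub(1)[OF that(1)] stable[OF that(1,2,4)]
    by (auto simp: fun_eq_iff restrict_def compose_def)
  ultimately show ?thesis
    using sub(2) stable by (simp add: set_functor_def)
qed

lemma functor_compose:
  assumes "set_functor S F" "set_functor S G"
  shows "set_functor S (comp_functor G F)"
  unfolding set_functor_def[of S "comp_functor G F"]
  by (simp add: comp_functor_def functor_ob[OF assms(1)] functor_ob[OF assms(2)]
      functor_ar[OF assms(1)] functor_ar[OF assms(2)] functor_id[OF assms(1)]
      functor_id[OF assms(2)] functor_comp[OF assms(1)] functor_comp[OF assms(2)])

context set_category
begin

section \<open>The coded coproduct with one point\<close>

lemma opt_code_eq_iff [simp]: "opt_code S x = opt_code S y \<longleftrightarrow> x = y"
  using inj_opt_code by (auto dest: injD)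

lemma pair_code_eq_iff [simp]: "pair_code S x = pair_code S y \<longleftrightarrow> x = y"
  using inj_pair_code by (auto dest: injD)

lemma inv_opt_code [simp]: "inv (opt_code S) (opt_code S x) = x"
  using inj_opt_code by simp

lemma inv_pair_code [simp]: "inv (pair_code S) (pair_code S x) = x"
  using inj_pair_code by simp

lemma plus_one_iff:
  "w \<in> plus_one S X \<longleftrightarrow> w = opt_code S None \<or> (\<exists>x\<in>X. w = opt_code S (Some x))"
  by (auto simp: plus_one_def)

lemma coproj_apply [simp]: "x \<in> X \<Longrightarrow> coproj S X x = opt_code S (Some x)"
  by (simp add: coproj_def)

lemma coproj_PiE: "coproj S X \<in> X \<rightarrow>\<^sub>E plus_one S X"
  by (auto simp: coproj_def plus_one_iff)

lemma coproj_inj: "inj_on (coproj S X) X"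
  by (auto simp: inj_on_def)

lemma copair_None [simp]: "copair S X f z (opt_code S None) = z"
  by (simp add: copair_def plus_one_iff)

lemma copair_Some [simp]: "x \<in> X \<Longrightarrow> copair S X f z (opt_code S (Some x)) = f x"
  by (simp add: copair_def plus_one_iff)

lemma copair_PiE: "f \<in> X \<rightarrow>\<^sub>E Z \<Longrightarrow> z \<in> Z \<Longrightarrow> copair S X f z \<in> plus_one S X \<rightarrow>\<^sub>E Z"
  by (rule PiE_I) (auto simp: plus_one_iff copair_def)

text \<open>The added point goes to a value that \<open>f\<close> misses, so it cannot collide with
  a point of \<open>X\<close>.\<close>

lemma copair_inj: "inj_on f X \<Longrightarrow> z \<notin> f ` X \<Longrightarrow> inj_on (copair S X f z) (plus_one S X)"
  by (rule inj_onI) (auto simp: plus_one_iff dest: inj_onD)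

lemma plus_one_map_None [simp]: "plus_one_map S X Y f (opt_code S None) = opt_code S None"
  by (simp add: plus_one_map_def)

lemma plus_one_map_Some:
  "f \<in> X \<rightarrow>\<^sub>E Y \<Longrightarrow> x \<in> X \<Longrightarrow>
   plus_one_map S X Y f (opt_code S (Some x)) = opt_code S (Some (f x))"
  using PiE_mem[of f X "\<lambda>_. Y" x] by (simp add: plus_one_map_def compose_eq)

lemma plus_one_map_PiE:
  "f \<in> X \<rightarrow>\<^sub>E Y \<Longrightarrow> plus_one_map S X Y f \<in> plus_one S X \<rightarrow>\<^sub>E plus_one S Y"
  unfolding plus_one_map_def
  by (rule copair_PiE[OF compose_PiE[OF _ coproj_PiE]]) (auto simp: plus_one_iff)

lemma plus_one_map_inj:
  "f \<in> X \<rightarrow>\<^sub>E Y \<Longrightarrow> inj_on f X \<Longrightarrow> inj_on (plus_one_map S X Y f) (plus_one S X)"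
  by (rule inj_onI) (auto simp: plus_one_iff plus_one_map_Some dest: inj_onD)

section \<open>Monomorphisms and pullbacks in terms of elements\<close>

lemma monomorphism_iff_inj:
  "monomorphism S A B m \<longleftrightarrow> A \<in> Obj S \<and> B \<in> Obj S \<and> m \<in> A \<rightarrow>\<^sub>E B \<and> inj_on m A"
proof -
  have "inj_on m A" if m: "monomorphism S A B m"
  proof (rule inj_onI)
    fix x y assume xy: "x \<in> A" "y \<in> A" "m x = m y"
    \<comment> \<open>A point of \<open>A\<close> is a map from a one-point set; \<open>{x}\<close>
      is small as a subset of \<open>A\<close>, so it may serve as a test object for
      \<open>m\<close>.\<close>
    have "{x} \<in> Obj S"
      using m xy(1) by (auto simp: monomorphism_def intro: subset_Obj)
    moreover have "(\<lambda>t\<in>{x}. x) \<in> {x} \<rightarrow>\<^sub>E A" "(\<lambda>t\<in>{x}. y) \<in> {x} \<rightarrow>\<^sub>E A"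
      using xy by auto
    moreover have "compose {x} m (\<lambda>t\<in>{x}. x) = compose {x} m (\<lambda>t\<in>{x}. y)"
      using xy by (auto simp: compose_def fun_eq_iff)
    ultimately have "(\<lambda>t\<in>{x}. x) = (\<lambda>t\<in>{x}. y)"
      using m unfolding monomorphism_def by blast
    then show "x = y"
      by (metis restrict_apply' singletonI)
  qed
  moreover have "g = h"
    if "inj_on m A" "g \<in> T \<rightarrow>\<^sub>E A" "h \<in> T \<rightarrow>\<^sub>E A" "compose T m g = compose T m h" for T g h
  proof (rule PiE_ext[OF that(2,3)])
    fix x assume "x \<in> T"
    then show "g x = h x"
      using that by (metis compose_eq inj_onD PiE_mem)
  qed
  ultimately show ?thesis
    unfolding monomorphism_def by blast
qed

text \<open>Maps out of a one-point set turn the universal property into the statement about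
  elements; conversely, the unique elements over \<open>a t\<close> and \<open>b t\<close> assemble
  into the mediating map.\<close>

lemma pullback_iff_elements:
  "pullback S P A B C p q f g \<longleftrightarrow>
     P \<in> Obj S \<and> A \<in> Obj S \<and> B \<in> Obj S \<and> C \<in> Obj S \<and>
     p \<in> P \<rightarrow>\<^sub>E A \<and> q \<in> P \<rightarrow>\<^sub>E B \<and> f \<in> A \<rightarrow>\<^sub>E C \<and> g \<in> B \<rightarrow>\<^sub>E C \<and>
     (\<forall>x\<in>P. f (p x) = g (q x)) \<and>
     (\<forall>a\<in>A. \<forall>b\<in>B. f a = g b \<longrightarrow> (\<exists>!x. x \<in> P \<and> p x = a \<and> q x = b))"
  (is "?L \<longleftrightarrow> ?R" is "_ \<longleftrightarrow> _ \<and> _ \<and> _ \<and> _ \<and> _ \<and> _ \<and> _ \<and> _ \<and> ?comm \<and> ?ex")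
proof -
  have comm: "compose P f p = compose P g q \<longleftrightarrow> ?comm"
    by (auto simp: compose_def fun_eq_iff restrict_def)
  have ex: "?ex" if L: ?L
  proof (intro ballI impI)
    fix a b assume ab: "a \<in> A" "b \<in> B" "f a = g b"
    \<comment> \<open>The one-point test object is chosen inside \<open>A\<close>, so that it is
      small.\<close>
    let ?K = "{a}"
    have univ: "\<exists>!u. u \<in> ?K \<rightarrow>\<^sub>E P \<and> compose ?K p u = (\<lambda>_\<in>?K. a) \<and> compose ?K q u = (\<lambda>_\<in>?K. b)"
    proof -
      have "?K \<in> Obj S"
        using L ab(1) by (auto simp: pullback_def intro: subset_Obj)
      moreover have "(\<lambda>_\<in>?K. a) \<in> ?K \<rightarrow>\<^sub>E A" "(\<lambda>_\<in>?K. b) \<in> ?K \<rightarrow>\<^sub>E B"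
        using ab by auto
      moreover have "compose ?K f (\<lambda>_\<in>?K. a) = compose ?K g (\<lambda>_\<in>?K. b)"
        using ab by (auto simp: compose_def fun_eq_iff)
      ultimately show ?thesis
        using L by (simp add: pullback_def)
    qed
    from univ obtain u where
      u: "u \<in> ?K \<rightarrow>\<^sub>E P \<and> compose ?K p u = (\<lambda>_\<in>?K. a) \<and> compose ?K q u = (\<lambda>_\<in>?K. b)" and
      uniq: "\<forall>v. v \<in> ?K \<rightarrow>\<^sub>E P \<and> compose ?K p v = (\<lambda>_\<in>?K. a) \<and> compose ?K q v = (\<lambda>_\<in>?K. b) \<longrightarrow> v = u"
      by (rule ex1E)
    have "compose ?K p u a = a" "compose ?K q u a = b"
      using u by simp_all
    show "\<exists>!x. x \<in> P \<and> p x = a \<and> q x = b"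
    proof (rule ex1I[of _ "u a"])
      show "u a \<in> P \<and> p (u a) = a \<and> q (u a) = b"
        using \<open>compose ?K p u a = a\<close> \<open>compose ?K q u a = b\<close>
          PiE_mem[OF conjunct1[OF u]] by (simp add: compose_eq)
    next
      fix x assume x: "x \<in> P \<and> p x = a \<and> q x = b"
      then have "(\<lambda>_\<in>?K. x) \<in> ?K \<rightarrow>\<^sub>E P" "compose ?K p (\<lambda>_\<in>?K. x) = (\<lambda>_\<in>?K. a)"
        "compose ?K q (\<lambda>_\<in>?K. x) = (\<lambda>_\<in>?K. b)"
        by (auto simp: compose_def fun_eq_iff)
      then have "(\<lambda>_\<in>?K. x) = u"
        by (intro uniq[rule_format] conjI)
      from fun_cong[OF this, of a] show "x = u a"
        by simp
    qed
  qed
  have univ: "\<exists>!u. u \<in> T \<rightarrow>\<^sub>E P \<and> compose T p u = a \<and> compose T q u = b"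
    if ex: ?ex and ab: "a \<in> T \<rightarrow>\<^sub>E A" "b \<in> T \<rightarrow>\<^sub>E B" "compose T f a = compose T g b" for T a b
  proof -
    have ex1: "\<exists>!x. x \<in> P \<and> p x = a t \<and> q x = b t" if "t \<in> T" for t
    proof -
      have "f (a t) = g (b t)"
        using fun_cong[OF ab(3), of t] that by (simp add: compose_eq)
      then show ?thesis
        using ex PiE_mem[OF ab(1) that] PiE_mem[OF ab(2) that] by simp
    qed
    \<comment> \<open>Unique choice at each point; the restriction to \<open>T\<close> makes
      \<open>u\<close> extensional, as arrows have to be.\<close>
    define u where "u = (\<lambda>t\<in>T. THE x. x \<in> P \<and> p x = a t \<and> q x = b t)"
    have u: "u t \<in> P \<and> p (u t) = a t \<and> q (u t) = b t" if "t \<in> T" for t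
      using theI'[OF ex1[OF that]] that by (simp add: u_def)
    show ?thesis
    proof (rule ex1I[of _ u])
      have "u \<in> T \<rightarrow>\<^sub>E P"
        using u by (auto simp: u_def)
      moreover have "compose T p u = a" "compose T q u = b"
        using u ab by (auto intro!: extensionalityI[of _ T] simp: compose_eq PiE_def)
      ultimately show "u \<in> T \<rightarrow>\<^sub>E P \<and> compose T p u = a \<and> compose T q u = b"
        by blast
    next
      fix v assume v: "v \<in> T \<rightarrow>\<^sub>E P \<and> compose T p v = a \<and> compose T q v = b"
      show "v = u"
      proof (rule extensionalityI[of _ T])
        show "v \<in> extensional T" "u \<in> extensional T"
          using v by (auto simp: u_def PiE_def)
        fix t assume t: "t \<in> T"
        have "compose T p v t = a t" "compose T q v t = b t"
          using v by simp_all
        with PiE_mem[OF conjunct1[OF v] t] t have "v t \<in> P \<and> p (v t) = a t \<and> q (v t) = b t"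
          by (simp add: compose_eq)
        then show "v t = u t"
          using ex1[OF t] u[OF t] by blast
      qed
    qed
  qed
  show ?thesis
  proof
    assume L: ?L
    then show ?R
      using ex[OF L] by (simp add: pullback_def comm)
  next
    assume R: ?R
    then have ?ex by (elim conjE)
    then show ?L
      unfolding pullback_def comm using R by (intro conjI ballI impI univ) simp_all
  qed
qed

section \<open>Taut functors\<close>

lemma taut_imp_functor: "taut_functor S F \<Longrightarrow> set_functor S F"
  by (simp add: taut_functor_def)

text \<open>The form in which tautness is applied below. For the square to be a pullback it is
  enough that \<open>a\<close> lies in the image of \<open>p\<close>: the other coordinate is then
  forced by injectivity of \<open>g\<close>, and uniqueness follows from injectivity of
  \<open>p\<close>.\<close>

lemma taut_pullback:
  assumes F: "taut_functor S F"
    and obs: "P \<in> Obj S" "A \<in> Obj S" "B \<in> Obj S" "C \<in> Obj S"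
    and maps: "p \<in> P \<rightarrow>\<^sub>E A" "q \<in> P \<rightarrow>\<^sub>E B" "f \<in> A \<rightarrow>\<^sub>E C" "g \<in> B \<rightarrow>\<^sub>E C"
    and inj: "inj_on g B" "inj_on p P"
    and comm: "\<And>x. x \<in> P \<Longrightarrow> f (p x) = g (q x)"
    and ex: "\<And>a b. a \<in> A \<Longrightarrow> b \<in> B \<Longrightarrow> f a = g b \<Longrightarrow> a \<in> p ` P"
    and ab: "a \<in> ob F A" "b \<in> ob F B" "ar F A C f a = ar F B C g b"
  shows "\<exists>x\<in>ob F P. ar F P A p x = a \<and> ar F P B q x = b"
proof -
  have "monomorphism S B C g"
    using obs maps inj by (simp add: monomorphism_iff_inj)
  moreover have "\<exists>!x. x \<in> P \<and> p x = a \<and> q x = b" if "a \<in> A" "b \<in> B" "f a = g b" for a b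
  proof -
    from ex[OF that] obtain x where x: "x \<in> P" "p x = a"
      by blast
    then have "q x = b"
      using comm[OF x(1)] that inj(1) PiE_mem[OF maps(2) x(1)] by (simp add: inj_on_eq_iff)
    then show ?thesis
      using x inj(2) by (auto dest: inj_onD)
  qed
  then have "pullback S P A B C p q f g"
    using obs maps comm by (simp add: pullback_iff_elements)
  ultimately have "pullback S (ob F P) (ob F A) (ob F B) (ob F C)
          (ar F P A p) (ar F P B q) (ar F A C f) (ar F B C g)"
    using F unfolding taut_functor_def by blast
  then show ?thesis
    unfolding pullback_iff_elements using ab by blast
qed

text \<open>The square with two identities over \<open>m\<close> and \<open>m\<close> is a pullback
  because \<open>m\<close> is injective; its preservation says that \<open>ar F A B m\<close> is
  injective.\<close>

lemma taut_inj:
  assumes F: "taut_functor S F" and obs: "A \<in> Obj S" "B \<in> Obj S"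
    and m: "m \<in> A \<rightarrow>\<^sub>E B" "inj_on m A"
  shows "inj_on (ar F A B m) (ob F A)"
proof (rule inj_onI)
  fix x y assume xy: "x \<in> ob F A" "y \<in> ob F A" "ar F A B m x = ar F A B m y"
  let ?id = "\<lambda>x\<in>A. x"
  have "\<exists>u\<in>ob F A. ar F A A ?id u = x \<and> ar F A A ?id u = y"
    by (rule taut_pullback[OF F obs(1,1,1,2) _ _ m(1,1,2) _ _ _ xy]) (auto intro: inj_onI)
  then show "x = y" by metis
qed

text \<open>\<open>F\<close> turns an inverse image square into a pullback whose leg
  \<open>ar F B C g\<close> is again a monomorphism by \<open>taut_inj\<close>, so the tautness of
  \<open>G\<close> applies to it.\<close>

lemma taut_compose:
  assumes F: "taut_functor S F" and G: "taut_functor S G"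
  shows "taut_functor S (comp_functor G F)"
proof -
  have "monomorphism S (ob F B) (ob F C) (ar F B C g)" if "monomorphism S B C g" for B C g
    using that taut_inj[OF F] taut_imp_functor[OF F]
    by (simp add: monomorphism_iff_inj functor_ob functor_ar)
  moreover have "set_functor S (comp_functor G F)"
    using F G by (intro functor_compose taut_imp_functor)
  ultimately show ?thesis
    using F G unfolding taut_functor_def by (auto simp: comp_functor_def)
qed

section \<open>The difference functor\<close>

lemma set_functor_plus_one: "set_functor S \<lparr>ob = plus_one S, ar = plus_one_map S\<rparr>"
proof -
  have "plus_one_map S X X (\<lambda>x\<in>X. x) = (\<lambda>w\<in>plus_one S X. w)" for X
  proof -
    have id: "(\<lambda>x\<in>X. x) \<in> X \<rightarrow>\<^sub>E X"
      by (rule restrict_PiE_iff[THEN iffD2]) simp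
    show ?thesis
    proof (rule PiE_ext[OF plus_one_map_PiE[OF id]])
      show "(\<lambda>w\<in>plus_one S X. w) \<in> plus_one S X \<rightarrow>\<^sub>E plus_one S X"
        by (rule restrict_PiE_iff[THEN iffD2]) simp
      fix w assume w: "w \<in> plus_one S X"
      then have "plus_one_map S X X (\<lambda>x\<in>X. x) w = w"
        unfolding plus_one_iff by (elim disjE bexE) (simp_all add: plus_one_map_Some[OF id])
      then show "plus_one_map S X X (\<lambda>x\<in>X. x) w = (\<lambda>w\<in>plus_one S X. w) w"
        using w by simp
    qed
  qed
  moreover have "plus_one_map S X Z (compose X g f) =
      compose (plus_one S X) (plus_one_map S Y Z g) (plus_one_map S X Y f)"
    if "f \<in> X \<rightarrow>\<^sub>E Y" "g \<in> Y \<rightarrow>\<^sub>E Z" for X Y Z f g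
  proof (rule PiE_ext)
    show "plus_one_map S X Z (compose X g f) \<in> plus_one S X \<rightarrow>\<^sub>E plus_one S Z"
      "compose (plus_one S X) (plus_one_map S Y Z g) (plus_one_map S X Y f)
        \<in> plus_one S X \<rightarrow>\<^sub>E plus_one S Z"
      by (rule plus_one_map_PiE[OF compose_PiE[OF that]],
          rule compose_PiE[OF plus_one_map_PiE[OF that(1)] plus_one_map_PiE[OF that(2)]])
    fix w assume w: "w \<in> plus_one S X"
    have "plus_one_map S X Z (compose X g f) w = plus_one_map S Y Z g (plus_one_map S X Y f w)"
      using w unfolding plus_one_iff
      by (elim disjE bexE) (simp_all add: plus_one_map_Some[OF compose_PiE[OF that]]
        plus_one_map_Some[OF that(1)] plus_one_map_Some[OF that(2)] PiE_mem[OF that(1)] compose_eq)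
    then show "plus_one_map S X Z (compose X g f) w =
        compose (plus_one S X) (plus_one_map S Y Z g) (plus_one_map S X Y f) w"
      using w by (simp add: compose_eq)
  qed
  ultimately show ?thesis
    by (simp add: set_functor_def plus_one_Obj plus_one_map_PiE)
qed

text \<open>\<open>F\<close> applied to the naturality square of the coprojections.\<close>

lemma functor_coproj_square:
  assumes "set_functor S F" "X \<in> Obj S" "Y \<in> Obj S" "f \<in> X \<rightarrow>\<^sub>E Y" "x \<in> ob F X"
  shows "ar F (plus_one S X) (plus_one S Y) (plus_one_map S X Y f)
      (ar F X (plus_one S X) (coproj S X) x) =
    ar F Y (plus_one S Y) (coproj S Y) (ar F X Y f x)"
  by (rule functor_square[OF assms(1,2) _ assms(3) _ coproj_PiE plus_one_map_PiE assms(4)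
        coproj_PiE _ assms(5)])
    (simp_all add: plus_one_Obj assms plus_one_map_Some[OF assms(4)] PiE_mem[OF assms(4)])

text \<open>The inverse image of \<open>Y\<close> along \<open>f + 1\<close> is exactly
  \<open>X\<close>, since the added point goes to the added point. So the naturality square of the
  coprojections is a pullback with a monic leg, and \<open>F\<close> preserves it.\<close>

lemma taut_coproj_pullback:
  assumes F: "taut_functor S F" and obs: "X \<in> Obj S" "Y \<in> Obj S" and f: "f \<in> X \<rightarrow>\<^sub>E Y"
    and ab: "a \<in> ob F (plus_one S X)" "b \<in> ob F Y"
      "ar F (plus_one S X) (plus_one S Y) (plus_one_map S X Y f) a =
       ar F Y (plus_one S Y) (coproj S Y) b"
  shows "\<exists>x\<in>ob F X. ar F X (plus_one S X) (coproj S X) x = a \<and> ar F X Y f x = b"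
proof (rule taut_pullback[OF F obs(1) plus_one_Obj[OF obs(1)] obs(2) plus_one_Obj[OF obs(2)]
      coproj_PiE f plus_one_map_PiE[OF f] coproj_PiE coproj_inj coproj_inj _ _ ab])
  show "plus_one_map S X Y f (coproj S X x) = coproj S Y (f x)" if "x \<in> X" for x
    using that f PiE_mem[OF f that] by (simp add: plus_one_map_Some[OF f])
  show "a \<in> coproj S X ` X"
    if "a \<in> plus_one S X" "b \<in> Y" "plus_one_map S X Y f a = coproj S Y b" for a b
    using that by (auto simp: plus_one_iff plus_one_map_Some[OF f])
qed

lemma functor_diff:
  assumes F: "taut_functor S F"
  shows "set_functor S (diff_functor S F)"
proof -
  note F' = taut_imp_functor[OF F]
  \<comment> \<open>The functor \<open>X \<mapsto> F(X + 1)\<close>, in which \<Delta>[F] sits as a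
    subfunctor.\<close>
  let ?H = "comp_functor F \<lparr>ob = plus_one S, ar = plus_one_map S\<rparr>"
  have "set_functor S \<lparr>ob = diff_ob S F, ar = \<lambda>X Y f. restrict (ar ?H X Y f) (diff_ob S F X)\<rparr>"
  proof (rule functor_restrict)
    show H: "set_functor S ?H"
      by (rule functor_compose[OF set_functor_plus_one F'])
    show sub: "diff_ob S F X \<subseteq> ob ?H X" for X
      by (auto simp: diff_ob_def comp_functor_def)
    show "diff_ob S F X \<in> Obj S" if "X \<in> Obj S" for X
      using subset_Obj[OF functor_ob[OF H that] sub] .
    fix X Y f u assume *: "X \<in> Obj S" "Y \<in> Obj S" "f \<in> X \<rightarrow>\<^sub>E Y" "u \<in> diff_ob S F X"
    then have u: "u \<in> ob ?H X" using sub by blast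
    \<comment> \<open>If the image of \<open>u\<close> came from \<open>F(Y)\<close>, then
      \<open>u\<close> would come from \<open>F(X)\<close> by the pullback, against \<open>u\<close>
      in \<Delta>[F](X).\<close>
    moreover have "ar ?H X Y f u \<notin> ar F Y (plus_one S Y) (coproj S Y) ` ob F Y"
      using taut_coproj_pullback[OF F *(1-3)] *(4)
      by (fastforce simp: comp_functor_def diff_ob_def)
    ultimately show "ar ?H X Y f u \<in> diff_ob S F Y"
      using functor_ar_mem[OF H *(1-3) u] by (simp add: diff_ob_def comp_functor_def)
  qed
  then show ?thesis
    by (simp add: diff_functor_def comp_functor_def)
qed

section \<open>Binary products of functors\<close>

lemma binprod_iff: "w \<in> binprod S X Y \<longleftrightarrow> (\<exists>x\<in>X. \<exists>y\<in>Y. w = pair_code S (x, y))"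
  by (auto simp: binprod_def)

lemma binprod_map_apply [simp]:
  "x \<in> X \<Longrightarrow> y \<in> Y \<Longrightarrow> binprod_map S X Y f g (pair_code S (x, y)) = pair_code S (f x, g y)"
  by (simp add: binprod_map_def binprod_iff)

lemma binprod_map_PiE:
  "f \<in> X \<rightarrow>\<^sub>E X' \<Longrightarrow> g \<in> Y \<rightarrow>\<^sub>E Y' \<Longrightarrow> binprod_map S X Y f g \<in> binprod S X Y \<rightarrow>\<^sub>E binprod S X' Y'"
  by (rule PiE_I) (auto simp: binprod_iff binprod_map_def)

lemma functor_binprod:
  assumes F: "set_functor S F" and G: "set_functor S G"
  shows "set_functor S (binprod_functor S F G)"
proof -
  have "binprod_map S X Y (\<lambda>x\<in>X. x) (\<lambda>y\<in>Y. y) = (\<lambda>w\<in>binprod S X Y. w)" for X Y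
    unfolding binprod_map_def by (rule restrict_ext) (auto simp: binprod_iff)
  moreover have "binprod_map S X Y (compose X f' f) (compose Y g' g) =
      compose (binprod S X Y) (binprod_map S X' Y' f' g') (binprod_map S X Y f g)"
    if "f \<in> X \<rightarrow>\<^sub>E X'" "g \<in> Y \<rightarrow>\<^sub>E Y'" for X Y X' Y' f g f' g'
  proof (rule extensionalityI[of _ "binprod S X Y"])
    fix w assume w: "w \<in> binprod S X Y"
    then obtain x y where "x \<in> X" "y \<in> Y" "w = pair_code S (x, y)"
      by (auto simp: binprod_iff)
    then show "binprod_map S X Y (compose X f' f) (compose Y g' g) w =
        compose (binprod S X Y) (binprod_map S X' Y' f' g') (binprod_map S X Y f g) w"
      using w PiE_mem[OF that(1), of x] PiE_mem[OF that(2), of y] by (simp add: compose_eq)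
  qed (simp_all add: binprod_map_def)
  ultimately show ?thesis
    unfolding set_functor_def[of S "binprod_functor S F G"]
    by (simp add: binprod_functor_def functor_ob[OF F] functor_ob[OF G] binprod_Obj
        binprod_map_PiE functor_id[OF F] functor_id[OF G] functor_comp[OF F] functor_comp[OF G]
        functor_ar[OF F] functor_ar[OF G])
qed

end

section \<open>The chain rule transformation on elements\<close>

locale taut_functor_pair = set_category S for S :: "'u setcat" +
  fixes F G :: "'u endofun"
  assumes F: "taut_functor S F" and G: "taut_functor S G"
begin

abbreviation P :: "'u set \<Rightarrow> 'u set" where
  "P \<equiv> plus_one S"

abbreviation Fj :: "'u set \<Rightarrow> 'u \<Rightarrow> 'u" where
  "Fj A \<equiv> ar F A (P A) (coproj S A)"

definition adjoin :: "'u set \<Rightarrow> 'u \<Rightarrow> 'u \<Rightarrow> 'u" where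
  "adjoin A a = copair S (ob F A) (Fj A) a"

text \<open>The value of \<open>chain_rule\<close> at the pair \<open>(b, a)\<close>, freed from the
  coding of pairs and from membership in the differences. This freedom is used in
  \<open>gamma_mem\<close>, where \<open>gamma\<close> is evaluated at a point in the image of
  \<open>G(j)\<close>.\<close>

definition gamma :: "'u set \<Rightarrow> 'u \<Rightarrow> 'u \<Rightarrow> 'u" where
  "gamma A b a = ar G (P (ob F A)) (ob F (P A)) (adjoin A a) b"

lemmas F' = taut_imp_functor[OF F]
lemmas G' = taut_imp_functor[OF G]

lemmas obs = functor_ob[OF F'] plus_one_Obj

lemma Fj_PiE: "A \<in> Obj S \<Longrightarrow> Fj A \<in> ob F A \<rightarrow>\<^sub>E ob F (P A)"
  by (intro functor_ar[OF F'] coproj_PiE obs)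

lemma Fj_inj: "A \<in> Obj S \<Longrightarrow> inj_on (Fj A) (ob F A)"
  by (intro taut_inj[OF F] coproj_PiE coproj_inj obs)

lemma adjoin_None [simp]: "adjoin A a (opt_code S None) = a"
  by (simp add: adjoin_def)

lemma adjoin_Some [simp]: "x \<in> ob F A \<Longrightarrow> adjoin A a (opt_code S (Some x)) = Fj A x"
  by (simp add: adjoin_def)

lemma adjoin_PiE: "A \<in> Obj S \<Longrightarrow> a \<in> ob F (P A) \<Longrightarrow> adjoin A a \<in> P (ob F A) \<rightarrow>\<^sub>E ob F (P A)"
  unfolding adjoin_def by (intro copair_PiE Fj_PiE)

lemma diff_obD:
  "x \<in> diff_ob S H X \<Longrightarrow> x \<in> ob H (P X)"
  "x \<in> diff_ob S H X \<Longrightarrow> y \<in> ob H X \<Longrightarrow> ar H X (P X) (coproj S X) y \<noteq> x"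
  by (auto simp: diff_ob_def)

text \<open>\<open>F(j)\<close> is injective because \<open>F\<close> is taut, and \<open>a\<close>
  lies outside its image.\<close>

lemma adjoin_inj: "A \<in> Obj S \<Longrightarrow> a \<in> diff_ob S F A \<Longrightarrow> inj_on (adjoin A a) (P (ob F A))"
  unfolding adjoin_def by (rule copair_inj[OF Fj_inj]) (auto dest: diff_obD(2))

text \<open>\<open>G\<close> is applied to a square of maps from \<open>F(X) + 1\<close> to
  \<open>F(Y + 1)\<close>. Both ways round send the added point to \<open>F(f + 1)(a)\<close>, and
  on \<open>F(X)\<close> they agree by naturality of \<open>F(j)\<close>.\<close>

lemma gamma_natural:
  assumes X: "X \<in> Obj S" and Y: "Y \<in> Obj S" and f: "f \<in> X \<rightarrow>\<^sub>E Y"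
    and a: "a \<in> ob F (P X)" and b: "b \<in> ob G (P (ob F X))"
  shows "ar G (ob F (P X)) (ob F (P Y)) (ar F (P X) (P Y) (plus_one_map S X Y f)) (gamma X b a) =
    gamma Y (ar G (P (ob F X)) (P (ob F Y)) (plus_one_map S (ob F X) (ob F Y) (ar F X Y f)) b)
      (ar F (P X) (P Y) (plus_one_map S X Y f) a)"
  unfolding gamma_def
proof (rule functor_square[OF G'])
  have Ff: "ar F X Y f \<in> ob F X \<rightarrow>\<^sub>E ob F Y"
    by (rule functor_ar[OF F' X Y f])
  show F1: "ar F (P X) (P Y) (plus_one_map S X Y f) \<in> ob F (P X) \<rightarrow>\<^sub>E ob F (P Y)"
    by (intro functor_ar[OF F'] plus_one_map_PiE f obs X Y)
  show "plus_one_map S (ob F X) (ob F Y) (ar F X Y f) \<in> P (ob F X) \<rightarrow>\<^sub>E P (ob F Y)"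
    by (rule plus_one_map_PiE[OF Ff])
  show "adjoin X a \<in> P (ob F X) \<rightarrow>\<^sub>E ob F (P X)"
    by (rule adjoin_PiE[OF X a])
  show "adjoin Y (ar F (P X) (P Y) (plus_one_map S X Y f) a) \<in> P (ob F Y) \<rightarrow>\<^sub>E ob F (P Y)"
    by (rule adjoin_PiE[OF Y PiE_mem[OF F1 a]])
  show "ar F (P X) (P Y) (plus_one_map S X Y f) (adjoin X a w) =
      adjoin Y (ar F (P X) (P Y) (plus_one_map S X Y f) a)
        (plus_one_map S (ob F X) (ob F Y) (ar F X Y f) w)" if "w \<in> P (ob F X)" for w
    using that functor_coproj_square[OF F' X Y f] PiE_mem[OF Ff]
    by (auto simp: plus_one_iff plus_one_map_Some[OF Ff])
qed (intro obs X Y b)+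

text \<open>\<open>[F(j), a]\<close> extends \<open>F(j)\<close>; apply \<open>G\<close>. This links
  the image of \<open>G(j)\<close>, removed from \<open>G(F(A) + 1)\<close>, with the image of
  \<open>G(F(j))\<close>, removed from \<open>G(F(A + 1))\<close>.\<close>

lemma gamma_coproj:
  assumes A: "A \<in> Obj S" and a: "a \<in> ob F (P A)" and y: "y \<in> ob G (ob F A)"
  shows "gamma A (ar G (ob F A) (P (ob F A)) (coproj S (ob F A)) y) a =
    ar G (ob F A) (ob F (P A)) (Fj A) y"
  unfolding gamma_def
  by (rule functor_triangle[OF G' _ _ _ coproj_PiE adjoin_PiE[OF A a] Fj_PiE[OF A] _ y])
    (simp_all add: obs A)

text \<open>By \<open>gamma_coproj\<close>, a value in the image of \<open>G(F(j))\<close> is also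
  the value at a point in the image of \<open>G(j)\<close>; injectivity of
  \<open>G([F(j), a])\<close> would identify that point with \<open>b\<close>.\<close>

lemma gamma_mem:
  assumes A: "A \<in> Obj S" and a: "a \<in> diff_ob S F A" and b: "b \<in> diff_ob S G (ob F A)"
  shows "gamma A b a \<in> diff_ob S (comp_functor G F) A"
proof -
  note adj = adjoin_PiE[OF A diff_obD(1)[OF a]] and inj = adjoin_inj[OF A a]
  have "gamma A b a \<in> ob G (ob F (P A))"
    unfolding gamma_def
    by (rule functor_ar_mem[OF G' _ _ adj diff_obD(1)[OF b]]) (intro obs A)+
  moreover have False
    if y: "y \<in> ob G (ob F A)" "gamma A b a = ar G (ob F A) (ob F (P A)) (Fj A) y" for y
  proof -
    let ?z = "ar G (ob F A) (P (ob F A)) (coproj S (ob F A)) y"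
    have "?z \<in> ob G (P (ob F A))"
      by (intro functor_ar_mem[OF G'] coproj_PiE obs A y)
    moreover have "gamma A b a = gamma A ?z a"
      using y gamma_coproj[OF A diff_obD(1)[OF a] y(1)] by simp
    moreover have "inj_on (ar G (P (ob F A)) (ob F (P A)) (adjoin A a)) (ob G (P (ob F A)))"
      by (intro taut_inj[OF G] adj inj obs A)
    ultimately have "?z = b"
      using diff_obD(1)[OF b] unfolding gamma_def by (metis inj_onD)
    then show False
      using diff_obD(2)[OF b y(1)] by simp
  qed
  ultimately show ?thesis
    by (auto simp: diff_ob_def comp_functor_def)
qed

text \<open>The coordinates \<open>a\<close> and \<open>a'\<close> are compared first, through the
  intersection of the two adjoined maps. Once they are equal, injectivity of
  \<open>G([F(j), a])\<close> yields \<open>b = b'\<close>.\<close>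

lemma gamma_eqD:
  assumes A: "A \<in> Obj S"
    and a: "a \<in> diff_ob S F A" and b: "b \<in> diff_ob S G (ob F A)"
    and a': "a' \<in> diff_ob S F A" and b': "b' \<in> diff_ob S G (ob F A)"
    and eq: "gamma A b a = gamma A b' a'"
  shows "b = b' \<and> a = a'"
proof -
  note adj = adjoin_PiE[OF A diff_obD(1)[OF a]] adjoin_PiE[OF A diff_obD(1)[OF a']]
  note b1 = diff_obD(1)[OF b] diff_obD(1)[OF b']
  have FA: "ob F A \<in> Obj S" "P (ob F A) \<in> Obj S" "ob F (P A) \<in> Obj S"
    by (intro obs A)+
  have "a = a'"
  proof (rule ccontr)
    assume ne: "a \<noteq> a'"
    \<comment> \<open>\<open>G\<close> preserves the intersection \<open>F(A)\<close> of the two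
      maps, which would make \<open>b\<close> come from \<open>G(F(A))\<close>.\<close>
    have "\<exists>x\<in>ob G (ob F A). ar G (ob F A) (P (ob F A)) (coproj S (ob F A)) x = b \<and>
        ar G (ob F A) (P (ob F A)) (coproj S (ob F A)) x = b'"
    proof (rule taut_pullback[OF G FA(1,2,2,3) coproj_PiE coproj_PiE adj
          adjoin_inj[OF A a'] coproj_inj _ _ b1 eq[unfolded gamma_def]])
      show "adjoin A a (coproj S (ob F A) x) = adjoin A a' (coproj S (ob F A) x)"
        if "x \<in> ob F A" for x
        using that by simp
      \<comment> \<open>Two added points are excluded by \<open>a \<noteq> a'\<close>; an added
        point against a point of \<open>F(A)\<close> is excluded because \<open>a\<close> and
        \<open>a'\<close> lie outside the image of \<open>F(j)\<close>.\<close>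
      show "v \<in> coproj S (ob F A) ` ob F A"
        if "v \<in> P (ob F A)" "w \<in> P (ob F A)" "adjoin A a v = adjoin A a' w" for v w
        using that ne diff_obD(2)[OF a] diff_obD(2)[OF a'] by (fastforce simp: plus_one_iff)
    qed
    then show False
      using diff_obD(2)[OF b] by blast
  qed
  moreover have "inj_on (ar G (P (ob F A)) (ob F (P A)) (adjoin A a)) (ob G (P (ob F A)))"
    by (rule taut_inj[OF G FA(2,3) adj(1) adjoin_inj[OF A a]])
  ultimately show ?thesis
    using eq b1 unfolding gamma_def by (auto dest: inj_onD)
qed

text \<open>The existence half of the pullback property. Pulling \<open>F(m + 1)\<close> back along
  \<open>[F(j), a]\<close> is used twice: to see that \<open>a\<close> comes from some
  \<open>a0\<close>, and then, with \<open>a0\<close> at hand, to obtain \<open>b0\<close>.\<close>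

lemma gamma_taut:
  assumes A0: "A0 \<in> Obj S" and A: "A \<in> Obj S" and m: "m \<in> A0 \<rightarrow>\<^sub>E A" "inj_on m A0"
    and a: "a \<in> diff_ob S F A" and b: "b \<in> diff_ob S G (ob F A)"
    and c: "c \<in> diff_ob S (comp_functor G F) A0"
    and eq: "gamma A b a =
      ar G (ob F (P A0)) (ob F (P A)) (ar F (P A0) (P A) (plus_one_map S A0 A m)) c"
  shows "\<exists>b0\<in>diff_ob S G (ob F A0). \<exists>a0\<in>diff_ob S F A0.
    ar G (P (ob F A0)) (P (ob F A)) (plus_one_map S (ob F A0) (ob F A) (ar F A0 A m)) b0 = b \<and>
    ar F (P A0) (P A) (plus_one_map S A0 A m) a0 = a \<and> gamma A0 b0 a0 = c"
proof -
  let ?m1 = "ar F (P A0) (P A) (plus_one_map S A0 A m)"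
  let ?Fm = "ar F A0 A m"
  let ?Fm1 = "plus_one_map S (ob F A0) (ob F A) ?Fm"
  have o: "ob F A0 \<in> Obj S" "P (ob F A0) \<in> Obj S" "ob F (P A0) \<in> Obj S"
    "ob F A \<in> Obj S" "P (ob F A) \<in> Obj S" "ob F (P A) \<in> Obj S"
    by (intro obs A A0)+
  have Fm: "?Fm \<in> ob F A0 \<rightarrow>\<^sub>E ob F A" "inj_on ?Fm (ob F A0)"
    by (intro functor_ar[OF F'] taut_inj[OF F] A A0 m)+
  have m1: "?m1 \<in> ob F (P A0) \<rightarrow>\<^sub>E ob F (P A)" "inj_on ?m1 (ob F (P A0))"
    by (intro functor_ar[OF F'] taut_inj[OF F] plus_one_map_PiE plus_one_map_inj obs A A0 m)+
  have Fm1: "?Fm1 \<in> P (ob F A0) \<rightarrow>\<^sub>E P (ob F A)" "inj_on ?Fm1 (P (ob F A0))"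
    by (intro plus_one_map_PiE plus_one_map_inj Fm)+
  have sq: "?m1 (Fj A0 x) = Fj A (?Fm x)" if "x \<in> ob F A0" for x
    by (rule functor_coproj_square[OF F' A0 A m(1) that])
  have pb: "\<exists>x\<in>ob F A0. Fj A0 x = u \<and> ?Fm x = v"
    if "u \<in> ob F (P A0)" "v \<in> ob F A" "?m1 u = Fj A v" for u v
    by (rule taut_coproj_pullback[OF F A0 A m(1) that])
  note adj = adjoin_PiE[OF A diff_obD(1)[OF a]]
  note b1 = diff_obD(1)[OF b]
  have c1: "c \<in> ob G (ob F (P A0))"
    using diff_obD(1)[OF c] by (simp add: comp_functor_def)
  \<comment> \<open>If \<open>a\<close> were not reached, the pullback would be \<open>F(A0)\<close>
    and \<open>c\<close> would come from \<open>G(F(A0))\<close>, which membership in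
    \<Delta>[G \<circ> F](A0) forbids.\<close>
  have "\<exists>a0\<in>ob F (P A0). ?m1 a0 = a"
  proof (rule ccontr)
    assume "\<not> ?thesis"
    then have na: "?m1 u \<noteq> a" if "u \<in> ob F (P A0)" for u
      using that by blast
    let ?p = "compose (ob F A0) (coproj S (ob F A)) ?Fm"
    have "\<exists>x\<in>ob G (ob F A0). ar G (ob F A0) (P (ob F A)) ?p x = b \<and>
        ar G (ob F A0) (ob F (P A0)) (Fj A0) x = c"
    proof (rule taut_pullback[OF G o(1,5,3,6) compose_PiE[OF Fm(1) coproj_PiE] Fj_PiE[OF A0]
          adj m1 _ _ _ b1 c1 eq[unfolded gamma_def]])
      show "inj_on ?p (ob F A0)"
        using Fm(2) PiE_mem[OF Fm(1)] by (auto simp: inj_on_def compose_eq)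
      show "adjoin A a (?p x) = ?m1 (Fj A0 x)" if "x \<in> ob F A0" for x
        using that sq PiE_mem[OF Fm(1)] by (simp add: compose_eq)
      \<comment> \<open>\<open>v\<close> is not the added point, as its value \<open>a\<close> is
        not reached by \<open>?m1\<close>; a point of \<open>F(A)\<close> is lifted by
        \<open>pb\<close>.\<close>
      fix v w assume v: "v \<in> P (ob F A)" and w: "w \<in> ob F (P A0)" and vw: "adjoin A a v = ?m1 w"
      then obtain x where x: "x \<in> ob F A" "v = opt_code S (Some x)"
        using na[OF w] by (auto simp: plus_one_iff)
      then obtain z where "z \<in> ob F A0" "?Fm z = x"
        using pb[OF w x(1)] vw by auto
      then show "v \<in> ?p ` ob F A0"
        using x by (force simp: compose_eq)
    qed
    then show False
      using diff_obD(2)[OF c] by (auto simp: comp_functor_def)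
  qed
  then obtain a0 where a0: "a0 \<in> ob F (P A0)" "?m1 a0 = a"
    by blast
  \<comment> \<open>Had \<open>a0\<close> come from \<open>F(A0)\<close>, then \<open>a\<close>
    would come from \<open>F(A)\<close> by naturality of \<open>F(j)\<close>.\<close>
  have "Fj A0 y \<noteq> a0" if "y \<in> ob F A0" for y
    using sq[OF that] a0(2) diff_obD(2)[OF a PiE_mem[OF Fm(1) that]] by auto
  then have a0d: "a0 \<in> diff_ob S F A0"
    using a0(1) by (auto simp: diff_ob_def)
  \<comment> \<open>With \<open>a0\<close> over \<open>a\<close>, the added point of
    \<open>F(A) + 1\<close> is reached too, so the pullback is now \<open>F(A0) + 1\<close>, with
    projections \<open>F(m) + 1\<close> and \<open>[F(j), a0]\<close>.\<close>
  have "\<exists>x\<in>ob G (P (ob F A0)). ar G (P (ob F A0)) (P (ob F A)) ?Fm1 x = b \<and>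
      ar G (P (ob F A0)) (ob F (P A0)) (adjoin A0 a0) x = c"
  proof (rule taut_pullback[OF G o(2,5,3,6) Fm1(1) adjoin_PiE[OF A0 a0(1)] adj m1 Fm1(2)
        _ _ b1 c1 eq[unfolded gamma_def]])
    show "adjoin A a (?Fm1 x) = ?m1 (adjoin A0 a0 x)" if "x \<in> P (ob F A0)" for x
      using that sq a0(2) PiE_mem[OF Fm(1)]
      by (auto simp: plus_one_iff plus_one_map_Some[OF Fm(1)])
    fix v w assume v: "v \<in> P (ob F A)" and w: "w \<in> ob F (P A0)" and vw: "adjoin A a v = ?m1 w"
    show "v \<in> ?Fm1 ` P (ob F A0)"
    proof (cases "v = opt_code S None")
      case True
      then show ?thesis
        by (intro image_eqI[of _ _ "opt_code S None"]) (auto simp: plus_one_iff)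
    next
      case False
      then obtain x where x: "x \<in> ob F A" "v = opt_code S (Some x)"
        using v by (auto simp: plus_one_iff)
      then obtain z where "z \<in> ob F A0" "?Fm z = x"
        using pb[OF w x(1)] vw by auto
      then show ?thesis
        using x
        by (intro image_eqI[of _ _ "opt_code S (Some z)"])
          (auto simp: plus_one_iff plus_one_map_Some[OF Fm(1)])
    qed
  qed
  then obtain b0 where b0: "b0 \<in> ob G (P (ob F A0))"
    "ar G (P (ob F A0)) (P (ob F A)) ?Fm1 b0 = b" "gamma A0 b0 a0 = c"
    by (auto simp: gamma_def)
  \<comment> \<open>The argument for \<open>a0\<close> again, with \<open>G\<close> and
    \<open>F(m)\<close> in place of \<open>F\<close> and \<open>m\<close>.\<close>
  have "ar G (ob F A0) (P (ob F A0)) (coproj S (ob F A0)) y \<noteq> b0" if "y \<in> ob G (ob F A0)" for y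
    using functor_coproj_square[OF G' o(1,4) Fm(1) that] b0(2)
      diff_obD(2)[OF b functor_ar_mem[OF G' o(1,4) Fm(1) that]] by auto
  then have "b0 \<in> diff_ob S G (ob F A0)"
    using b0(1) by (auto simp: diff_ob_def)
  then show ?thesis
    using a0d a0(2) b0 by blast
qed

section \<open>Assembling the natural transformation\<close>

lemma ob_chain_source:
  "ob (chain_source S G F) A = binprod S (diff_ob S G (ob F A)) (diff_ob S F A)"
  by (simp add: chain_source_def binprod_functor_def comp_functor_def diff_functor_def)

lemma ar_chain_source:
  "b \<in> diff_ob S G (ob F X) \<Longrightarrow> a \<in> diff_ob S F X \<Longrightarrow>
   ar (chain_source S G F) X Y f (pair_code S (b, a)) =
   pair_code S
     (ar G (P (ob F X)) (P (ob F Y)) (plus_one_map S (ob F X) (ob F Y) (ar F X Y f)) b,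
      ar F (P X) (P Y) (plus_one_map S X Y f) a)"
  by (simp add: chain_source_def binprod_functor_def comp_functor_def diff_functor_def)

lemma ob_chain_target: "ob (chain_target S G F) A = diff_ob S (comp_functor G F) A"
  by (simp add: chain_target_def diff_functor_def)

lemma ar_chain_target:
  "c \<in> diff_ob S (comp_functor G F) X \<Longrightarrow>
   ar (chain_target S G F) X Y f c =
   ar G (ob F (P X)) (ob F (P Y)) (ar F (P X) (P Y) (plus_one_map S X Y f)) c"
  by (simp add: chain_target_def diff_functor_def comp_functor_def)

lemma chain_rule_pair:
  "b \<in> diff_ob S G (ob F A) \<Longrightarrow> a \<in> diff_ob S F A \<Longrightarrow>
   chain_rule S G F A (pair_code S (b, a)) = gamma A b a"
  by (simp add: chain_rule_def ob_chain_source binprod_iff gamma_def adjoin_def)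

lemma functor_chain_source: "set_functor S (chain_source S G F)"
  unfolding chain_source_def by (intro functor_binprod functor_compose functor_diff F F' G)

lemma functor_chain_target: "set_functor S (chain_target S G F)"
  unfolding chain_target_def by (intro functor_diff taut_compose F G)

lemma chain_rule_PiE:
  assumes A: "A \<in> Obj S"
  shows "chain_rule S G F A \<in> ob (chain_source S G F) A \<rightarrow>\<^sub>E ob (chain_target S G F) A"
proof (rule PiE_I)
  fix w assume "w \<in> ob (chain_source S G F) A"
  then show "chain_rule S G F A w \<in> ob (chain_target S G F) A"
    using gamma_mem[OF A] by (auto simp: ob_chain_source ob_chain_target binprod_iff chain_rule_pair)
qed (simp add: chain_rule_def)

lemma chain_rule_inj:
  assumes A: "A \<in> Obj S"
  shows "inj_on (chain_rule S G F A) (ob (chain_source S G F) A)"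
  by (rule inj_onI)
    (auto simp: ob_chain_source binprod_iff chain_rule_pair dest: gamma_eqD[OF A, rotated -1])

lemma chain_rule_natural_apply:
  assumes X: "X \<in> Obj S" and Y: "Y \<in> Obj S" and f: "f \<in> X \<rightarrow>\<^sub>E Y"
    and w: "w \<in> ob (chain_source S G F) X"
  shows "chain_rule S G F Y (ar (chain_source S G F) X Y f w) =
    ar (chain_target S G F) X Y f (chain_rule S G F X w)"
proof -
  obtain b a where ba: "b \<in> diff_ob S G (ob F X)" "a \<in> diff_ob S F X" "w = pair_code S (b, a)"
    using w by (auto simp: ob_chain_source binprod_iff)
  have "ar (chain_source S G F) X Y f w \<in> ob (chain_source S G F) Y"
    by (rule functor_ar_mem[OF functor_chain_source X Y f w])
  then show ?thesis
    using gamma_natural[OF X Y f diff_obD(1)[OF ba(2)] diff_obD(1)[OF ba(1)]] gamma_mem[OF X ba(2,1)]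
    by (auto simp: ba ar_chain_source ar_chain_target ob_chain_source binprod_iff chain_rule_pair)
qed

lemma chain_rule_natural: "nat_trans S (chain_source S G F) (chain_target S G F) (chain_rule S G F)"
  unfolding nat_trans_def
  using functor_chain_source functor_chain_target chain_rule_PiE chain_rule_natural_apply
  by (auto simp: compose_def fun_eq_iff restrict_def)

text \<open>\<open>gamma_taut\<close> supplies the element of the pullback, and injectivity of the
  component at \<open>A0\<close> alone makes it unique; the square commutes by naturality.\<close>

lemma chain_rule_taut: "taut_trans S (chain_source S G F) (chain_target S G F) (chain_rule S G F)"
proof -
  have "\<exists>!x. x \<in> ob (chain_source S G F) A0 \<and> ar (chain_source S G F) A0 A m x = w \<and>
      chain_rule S G F A0 x = c"
    if A0: "A0 \<in> Obj S" and A: "A \<in> Obj S" and m: "m \<in> A0 \<rightarrow>\<^sub>E A" "inj_on m A0"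
      and w: "w \<in> ob (chain_source S G F) A" and c: "c \<in> ob (chain_target S G F) A0"
      and eq: "chain_rule S G F A w = ar (chain_target S G F) A0 A m c" for A0 A m w c
  proof -
    obtain b a where ba: "b \<in> diff_ob S G (ob F A)" "a \<in> diff_ob S F A" "w = pair_code S (b, a)"
      using w by (auto simp: ob_chain_source binprod_iff)
    note c' = c[unfolded ob_chain_target]
    obtain b0 a0 where *: "b0 \<in> diff_ob S G (ob F A0)" "a0 \<in> diff_ob S F A0"
      "ar G (P (ob F A0)) (P (ob F A)) (plus_one_map S (ob F A0) (ob F A) (ar F A0 A m)) b0 = b"
      "ar F (P A0) (P A) (plus_one_map S A0 A m) a0 = a" "gamma A0 b0 a0 = c"
      using gamma_taut[OF A0 A m ba(2,1) c'] eq ba c'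
      by (auto simp: chain_rule_pair ar_chain_target)
    then have "pair_code S (b0, a0) \<in> ob (chain_source S G F) A0"
      "ar (chain_source S G F) A0 A m (pair_code S (b0, a0)) = w"
      "chain_rule S G F A0 (pair_code S (b0, a0)) = c"
      by (simp_all add: ob_chain_source binprod_iff ar_chain_source chain_rule_pair ba(3))
    then show ?thesis
      using chain_rule_inj[OF A0] by (metis inj_onD)
  qed
  then show ?thesis
    unfolding taut_trans_def pullback_iff_elements monomorphism_iff_inj
    using chain_rule_natural chain_rule_natural_apply functor_chain_source functor_chain_target
      chain_rule_PiE
    by (simp add: functor_ob functor_ar)
qed

text \<open>Monomorphisms are the injections here, so \<open>chain_rule_inj\<close> settles each
  component.\<close>

lemma chain_rule_monic: "monic_trans S (chain_source S G F) (chain_target S G F) (chain_rule S G F)"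
  unfolding monic_trans_def monomorphism_iff_inj
  using chain_rule_natural chain_rule_inj chain_rule_PiE functor_chain_source functor_chain_target
  by (simp add: functor_ob)

end

theorem theorem3p3p1:
  fixes S :: "'u setcat" and F G :: "'u endofun"
  assumes "set_category S"
    and "taut_functor S F"
    and "taut_functor S G"
  shows "nat_trans S (chain_source S G F) (chain_target S G F) (chain_rule S G F) \<and>
     taut_trans S (chain_source S G F) (chain_target S G F) (chain_rule S G F) \<and>
     monic_trans S (chain_source S G F) (chain_target S G F) (chain_rule S G F)"
proof -
  interpret taut_functor_pair S F G
    using assms by (simp add: taut_functor_pair_def taut_functor_pair_axioms_def)
  show ?thesis
    using chain_rule_natural chain_rule_taut chain_rule_monic by blast
qed

end
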